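(* Let $\mathbf m=(m_1,\ldots,m_w)$ be a non-zero vector of real numbers and $q=\min_{m_i\neq 0}|m_i|$. Assume that for $x\in(0,q)$ $$H_{\mathbf m}(x)=\sum_{i=1}^{\infty}\frac{\sigma^i x^i}{i^a}S_{\mathbf n}(\mathbf b;i)$$ with some $\sigma\in\mathbb R\setminus\{0\}$, $a\in\mathbb N$ and some $S$-sum $S_{\mathbf n}(\mathbf b;i)$. Then for every real $j>0$ and all $x\in(0,\min(j,q))$: $$H_{0,\mathbf m}(x)=\sum_{i=1}^{\infty}\frac{\sigma^i x^i}{i^{a+1}}S_{\mathbf n}(\mathbf b;i),$$ $$H_{j,\mathbf m}(x)=\sum_{i=1}^{\infty}\frac{x^i}{i\,j^i}S_{a,\mathbf n}(\sigma j,\mathbf b;i-1)=\sum_{i=1}^{\infty}\frac{x^i}{i\,j^i}S_{a,\mathbf n}(\sigma j,\mathbf b;i)-\sum_{i=1}^{\infty}\frac{\sigma^i x^i}{i^{a+1}}S_{\mathbf n}(\mathbf b;i),$$ $$H_{-j,\mathbf m}(x)=-\sum_{i=1}^{\infty}\frac{x^i}{i(-j)^i}S_{a,\mathbf n}(-\sigma j,\mathbf b;i-1)=-\sum_{i=1}^{\infty}\frac{x^i}{i(-j)^i}S_{a,\mathbf n}(-\sigma j,\mathbf b;i)+\sum_{i=1}^{\infty}\frac{\sigma^i x^i}{i^{a+1}}S_{\mathbf n}(\mathbf b;i).$$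
   Context: $\mathbb N=\{1,2,\dots\}$. Generalized harmonic polylogarithms: for $a\in\mathbb R$ put $f_0(x)=\frac1x$ and $f_a(x)=\frac{1}{|a|-\operatorname{sign}(a)\,x}$ for $a\ne0$. For real $m_1,\dots,m_w$ and $0<x<\min_{m_i>0}m_i$ (no upper bound if no $m_i$ is positive), $H(x)=1$ for the empty index vector, $H_{m_1,\ldots,m_w}(x)=\frac{1}{w!}(\log x)^w$ if all $m_i=0$, and otherwise $H_{m_1,\ldots,m_w}(x)=\int_0^x f_{m_1}(y)H_{m_2,\ldots,m_w}(y)\,dy$. $S$-sums: for $\mathbf n=(n_1,\dots,n_k)\in\mathbb N^k$, $\mathbf b=(b_1,\dots,b_k)\in(\mathbb R\setminus\{0\})^k$ and an integer $N\ge0$, $$S_{\mathbf n}(\mathbf b;N)=\sum_{i_1=1}^{N}\frac{b_1^{i_1}}{i_1^{n_1}}\sum_{i_2=1}^{i_1}\frac{b_2^{i_2}}{i_2^{n_2}}\cdots\sum_{i_k=1}^{i_{k-1}}\frac{b_k^{i_k}}{i_k^{n_k}},$$ with value $0$ if $N=0$, $k\geq 1$, and value $1$ if $k=0$ (empty vectors are allowed). $S_{a,\mathbf n}(c,\mathbf b;N)$ denotes the $S$-sum with index $a$ prepended to $\mathbf n$ and $c$ prepended to $\mathbf b$; $H_{0,\mathbf m}$, $H_{\pm j,\mathbf m}$ denote the polylogarithms with the index $0$, $\pm j$ prepended to $\mathbf m$. *)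

theory Defs
  imports "HOL-Analysis.Analysis"
begin

definition hpl_kernel :: "real \<Rightarrow> real \<Rightarrow> real" where
  "hpl_kernel a x = (if a = 0 then 1 / x else 1 / (\<bar>a\<bar> - sgn a * x))"

text \<open>
  Generalized harmonic polylogarithms. For \<open>x\<close> positive and below every positive index
  the integrands are integrable, and their value at the endpoint \<open>0\<close> is irrelevant;
  for other \<open>x\<close> the integral need not exist and \<open>hpl\<close> has no mathematical meaning.
\<close>

fun hpl :: "real list \<Rightarrow> real \<Rightarrow> real" where
  "hpl [] x = 1"
| "hpl (m # ms) x =
     (if \<forall>c \<in> set (m # ms). c = 0
      then 1 / fact (length (m # ms)) * ln x ^ length (m # ms)
      else integral {0..x} (\<lambda>y. hpl_kernel m y * hpl ms y))"

text \<open>\<open>S\<close>-sums; the last equation only covers index lists of different lengths, which do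
  not arise as \<open>S\<close>-sums.\<close>

fun S_sum :: "nat list \<Rightarrow> real list \<Rightarrow> nat \<Rightarrow> real" where
  "S_sum [] [] N = 1"
| "S_sum (n # ns) (b # bs) N = (\<Sum>i = 1..N. b ^ i / real i ^ n * S_sum ns bs i)"
| "S_sum _ _ N = 0"

text \<open>Convergent series indexed by \<open>i = 1, 2, \<dots>\<close>.\<close>

abbreviation sums_from_one :: "(nat \<Rightarrow> real) \<Rightarrow> real \<Rightarrow> bool" (infix "sums\<^sub>1" 50) where
  "f sums\<^sub>1 s \<equiv> (\<lambda>i. f (Suc i)) sums s"

end

theory Submission
  imports Defs
begin

text \<open>
  On \<open>(0, q)\<close> the function \<open>H\<^sub>m\<close> is the sum of a power series without constant term. Multiplying it
  by \<open>1 / y\<close> shifts this series; multiplying it by the geometric series \<open>sgn t * (\<Sum>k. y ^ k / t ^ (k + 1))\<close>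
  of \<open>f\<^sub>t\<close> gives a Cauchy product whose coefficients are the partial sums \<open>S\<^bsub>a,n\<^esub>(\<sigma> t, b; k)\<close>
  up to the factor \<open>sgn t / t ^ (k + 1)\<close>. Integrating termwise yields the expansions, and the variants
  with \<open>S\<^bsub>a,n\<^esub>(\<sigma> t, b; i)\<close> follow by splitting off the last summand of the \<open>S\<close>-sum.
\<close>

text \<open>The termwise antiderivative \<open>G\<close> is differentiable up to and including
  \<open>x\<close>, because the series converges beyond \<open>x\<close>, so the fundamental theorem
  applies. Integrability of \<open>f\<close> need not be assumed: it comes out of the
  argument.\<close>

lemma powser_sums_integral:
  fixes d :: "nat \<Rightarrow> real" and f :: "real \<Rightarrow> real"
  assumes f: "\<And>y. 0 < y \<Longrightarrow> y < r \<Longrightarrow> (\<lambda>k. d k * y ^ k) sums f y"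
    and x: "0 < x" "x < r"
  shows "(\<lambda>k. d k * x ^ Suc k / real (Suc k)) sums integral {0..x} f"
proof -
  define c where "c k = (if k = 0 then 0 else d (k - 1) / real k)" for k
  have c_0 [simp]: "c 0 = 0" and c_Suc: "c (Suc k) = d k / real (Suc k)" for k
    by (simp_all add: c_def)
  have diffs_c: "diffs c = d"
    by (simp add: diffs_def c_Suc fun_eq_iff)
  \<comment> \<open>Two radii beyond \<open>x\<close>: plain convergence at \<open>L\<close> gives
    absolute convergence at \<open>K\<close>, and \<open>x < K\<close> leaves room to differentiate
    at the endpoint \<open>x\<close>.\<close>
  obtain L where L: "x < L" "L < r"
    using dense x(2) by blast
  obtain K where K: "x < K" "K < L"
    using dense L(1) by blast
  have "summable (\<lambda>k. d k * L ^ k)"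
    using f[of L] L x by (auto simp: sums_iff)
  then have "summable (\<lambda>k. norm (d k * K ^ k))"
    by (rule powser_insidea) (use K x in auto)
  then have "summable (\<lambda>k. norm (d k * K ^ k) * K)"
    by (rule summable_mult2)
  then have "summable (\<lambda>k. c (Suc k) * K ^ Suc k)"
  proof (rule summable_comparison_test')
    fix k :: nat
    have "norm (c (Suc k) * K ^ Suc k) = norm (d k * K ^ k) * K / real (Suc k)"
      using K x by (simp add: c_Suc abs_mult)
    also have "\<dots> \<le> norm (d k * K ^ k) * K"
      using K x divide_left_mono[of 1 "real (Suc k)" "norm (d k * K ^ k) * K"] by simp
    finally show "norm (c (Suc k) * K ^ Suc k) \<le> norm (d k * K ^ k) * K" .
  qed
  then have c_summable: "summable (\<lambda>k. c k * K ^ k)"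
    by (subst summable_Suc_iff[symmetric])
  define G where "G y = (\<Sum>k. c k * y ^ k)" for y
  have deriv: "(G has_real_derivative (\<Sum>k. d k * y ^ k)) (at y)" if "0 \<le> y" "y \<le> x" for y
    using termdiffs_strong[OF c_summable, of y] that K x by (simp add: diffs_c G_def[abs_def])
  have series: "((\<lambda>y. \<Sum>k. d k * y ^ k) has_integral (G x - G 0)) {0..x}"
    using x deriv
    by (intro fundamental_theorem_of_calculus)
       (auto simp: has_real_derivative_iff_has_vector_derivative[symmetric]
             intro: has_field_derivative_at_within)
  have f_eq: "f y = (\<Sum>k. d k * y ^ k)" if "y \<in> {0..x} - {0}" for y
    using f[of y] that x by (simp add: sums_iff)
  \<comment> \<open>Nothing is known about \<open>f 0\<close>; a single point does not affect the
    integral.\<close>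
  have "(f has_integral (G x - G 0)) {0..x}"
    by (rule has_integral_spike[OF negligible_sing f_eq series])
  moreover have "G 0 = 0"
    unfolding G_def by (simp only: powser_zero c_0)
  ultimately have int: "integral {0..x} f = G x"
    by (simp add: integral_unique)
  have "(\<lambda>k. c k * x ^ k) sums G x"
    unfolding G_def using powser_inside[OF c_summable, of x] K x by (simp add: summable_sums)
  then have "(\<lambda>k. c (Suc k) * x ^ Suc k) sums G x"
    by (subst sums_Suc_iff) simp
  then show ?thesis
    by (simp add: int c_Suc)
qed

text \<open>Since \<open>\<bar>t\<bar> - sgn t * y = sgn t * (t - y)\<close>, the kernel is
  \<open>sgn t / (t - y)\<close> for either sign of \<open>t\<close>, a geometric series in
  \<open>y / t\<close>.\<close>

lemma hpl_kernel_sums: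
  assumes "t \<noteq> 0" "\<bar>y\<bar> < \<bar>t\<bar>"
  shows "(\<lambda>k. sgn t / t ^ Suc k * y ^ k) sums hpl_kernel t y"
proof -
  have "(\<lambda>k. sgn t / t * (y / t) ^ k) sums (sgn t / t * (1 / (1 - y / t)))"
    using assms by (intro sums_mult geometric_sums) (simp add: abs_divide)
  moreover have "sgn t / t * (1 / (1 - y / t)) = hpl_kernel t y"
    using assms by (cases "t > 0") (auto simp: hpl_kernel_def sgn_if divide_simps)
  moreover have "sgn t / t * (y / t) ^ k = sgn t / t ^ Suc k * y ^ k" for k
    by (simp add: power_divide)
  ultimately show ?thesis
    by simp
qed

lemma hpl_Cons_eq_integral:
  assumes "\<exists>c \<in> set m. c \<noteq> 0"
  shows "hpl (t # m) x = integral {0..x} (\<lambda>y. hpl_kernel t y * hpl m y)"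
  using assms by auto

text \<open>The series has no constant term, so dividing by \<open>y\<close> leaves a power series;
  integration restores the exponent and contributes the factor
  \<open>1 / real (Suc k)\<close>.\<close>

lemma hpl_zero_Cons_sums:
  fixes c :: "nat \<Rightarrow> real"
  assumes m: "\<exists>c \<in> set m. c \<noteq> 0"
    and c: "\<And>y. 0 < y \<Longrightarrow> y < q \<Longrightarrow> (\<lambda>k. c (Suc k) * y ^ Suc k) sums hpl m y"
    and x: "0 < x" "x < q"
  shows "(\<lambda>k. c (Suc k) * x ^ Suc k / real (Suc k)) sums hpl (0 # m) x"
  unfolding hpl_Cons_eq_integral[OF m]
proof (rule powser_sums_integral[OF _ x])
  fix y :: real
  assume y: "0 < y" "y < q"
  have "(\<lambda>k. c (Suc k) * y ^ Suc k / y) sums (hpl m y / y)"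
    by (intro sums_divide c y)
  then show "(\<lambda>k. c (Suc k) * y ^ k) sums (hpl_kernel 0 y * hpl m y)"
    using y by (simp add: hpl_kernel_def)
qed

text \<open>In the Cauchy product, \<open>c i\<close> meets \<open>sgn t / t ^ (k - i + 1)\<close>,
  which is \<open>t ^ i\<close> times a factor depending only on \<open>k\<close>; hence the partial
  sums of \<open>c i * t ^ i\<close>.\<close>

lemma hpl_Cons_sums:
  fixes c :: "nat \<Rightarrow> real"
  assumes m: "\<exists>c \<in> set m. c \<noteq> 0"
    and c: "\<And>y. 0 < y \<Longrightarrow> y < q \<Longrightarrow> (\<lambda>k. c (Suc k) * y ^ Suc k) sums hpl m y"
    and t: "t \<noteq> 0" and x: "0 < x" "x < min \<bar>t\<bar> q"
  shows "(\<lambda>k. sgn t / t ^ Suc k * (\<Sum>i = 1..k. c i * t ^ i) * x ^ Suc k / real (Suc k))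
    sums hpl (t # m) x"
  unfolding hpl_Cons_eq_integral[OF m]
proof (rule powser_sums_integral[OF _ x])
  fix y :: real
  assume y: "0 < y" "y < min \<bar>t\<bar> q"
  \<comment> \<open>The assumption says nothing about \<open>c 0\<close>; setting it to zero lets
    the product start at index 0.\<close>
  define e where "e k = (if k = 0 then 0 else c k)" for k
  have e: "(\<lambda>k. e k * z ^ k) sums hpl m z" if "0 < z" "z < q" for z
    using c[OF that] sums_Suc_iff[of "\<lambda>k. e k * z ^ k" "hpl m z"] by (simp add: e_def)
  \<comment> \<open>Convergence at a point \<open>z\<close> beyond \<open>y\<close> makes both
    factors absolutely convergent at \<open>y\<close>, as the Cauchy product requires.\<close>
  obtain z where z: "y < z" "z < min \<bar>t\<bar> q"
    using dense y(2) by blast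
  have "summable (\<lambda>k. norm (e k * y ^ k))"
    by (rule powser_insidea[of _ z]) (use sums_summable[OF e[of z]] y z in auto)
  moreover have "summable (\<lambda>k. norm (sgn t / t ^ Suc k * y ^ k))"
    by (rule powser_insidea[of _ z]) (use sums_summable[OF hpl_kernel_sums[of t z]] t y z in auto)
  ultimately have prod: "(\<lambda>k. \<Sum>i\<le>k. (e i * y ^ i) * (sgn t / t ^ Suc (k - i) * y ^ (k - i)))
      sums ((\<Sum>k. e k * y ^ k) * (\<Sum>k. sgn t / t ^ Suc k * y ^ k))"
    by (rule Cauchy_product_sums)
  have F: "(\<Sum>k. e k * y ^ k) = hpl m y"
    using e[of y] y by (simp add: sums_iff)
  have kernel: "(\<Sum>k. sgn t / t ^ Suc k * y ^ k) = hpl_kernel t y"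
    using hpl_kernel_sums[of t y] t y by (simp add: sums_iff)
  have coeff: "(\<Sum>i\<le>k. (e i * y ^ i) * (sgn t / t ^ Suc (k - i) * y ^ (k - i)))
      = sgn t / t ^ Suc k * (\<Sum>i = 1..k. c i * t ^ i) * y ^ k" for k
  proof -
    have summand: "(e i * y ^ i) * (sgn t / t ^ Suc (k - i) * y ^ (k - i))
        = sgn t / t ^ Suc k * y ^ k * (e i * t ^ i)" if "i \<le> k" for i
    proof -
      obtain p where "k = i + p"
        using le_Suc_ex[OF \<open>i \<le> k\<close>] by blast
      then show ?thesis
        using t by (simp add: power_add mult_ac)
    qed
    have "(\<Sum>i\<le>k. (e i * y ^ i) * (sgn t / t ^ Suc (k - i) * y ^ (k - i)))
        = sgn t / t ^ Suc k * y ^ k * (\<Sum>i\<le>k. e i * t ^ i)"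
      unfolding sum_distrib_left by (intro sum.cong refl summand) simp
    also have "(\<Sum>i\<le>k. e i * t ^ i) = (\<Sum>i = 1..k. c i * t ^ i)"
      by (rule sum.mono_neutral_cong_right) (auto simp: e_def)
    finally show ?thesis
      by simp
  qed
  show "(\<lambda>k. sgn t / t ^ Suc k * (\<Sum>i = 1..k. c i * t ^ i) * y ^ k)
      sums (hpl_kernel t y * hpl m y)"
    using prod unfolding F kernel coeff mult.commute[of "hpl m y"] .
qed

text \<open>The factor \<open>sgn t\<close> on the right cancels the sign of the kernel, so one
  formula serves \<open>j\<close> and \<open>- j\<close>. The bound \<open>i - 1\<close> arises
  because the coefficient of \<open>y ^ k\<close> moves to \<open>x ^ Suc k\<close> under
  integration.\<close>

lemma hpl_Cons_sums_S_sum: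
  fixes m :: "real list" and \<sigma> :: real
  assumes m: "\<exists>c \<in> set m. c \<noteq> 0"
    and expansion: "\<And>y. 0 < y \<Longrightarrow> y < q \<Longrightarrow>
      (\<lambda>i. \<sigma> ^ i * y ^ i / real i ^ a * S_sum n b i) sums\<^sub>1 hpl m y"
    and t: "t \<noteq> 0" and x: "0 < x" "x < min \<bar>t\<bar> q"
  shows "(\<lambda>i. x ^ i / (real i * t ^ i) * S_sum (a # n) (\<sigma> * t # b) (i - 1))
    sums\<^sub>1 (sgn t * hpl (t # m) x)"
proof -
  define c where "c i = \<sigma> ^ i / real i ^ a * S_sum n b i" for i
  have "(\<lambda>k. c (Suc k) * y ^ Suc k) sums hpl m y" if "0 < y" "y < q" for y
    using expansion[OF that] by (simp add: c_def mult_ac)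
  from sums_mult[OF hpl_Cons_sums[OF m this t x], where c = "sgn t"]
  have "(\<lambda>k. sgn t * (sgn t / t ^ Suc k * (\<Sum>i = 1..k. c i * t ^ i) * x ^ Suc k / real (Suc k)))
      sums (sgn t * hpl (t # m) x)" .
  moreover have "(\<Sum>i = 1..k. c i * t ^ i) = S_sum (a # n) (\<sigma> * t # b) k" for k
    by (simp add: c_def power_mult_distrib mult_ac)
  moreover have "sgn t * (sgn t / t ^ Suc k * s * x ^ Suc k / real (Suc k))
      = x ^ Suc k / (real (Suc k) * t ^ Suc k) * s" for k s
    using t by (cases "t > 0") (simp_all add: sgn_if mult_ac)
  ultimately show ?thesis
    by (simp only: diff_Suc_1)
qed

text \<open>In the top summand \<open>t ^ Suc k\<close> cancels, and the outer
  \<open>1 / real (Suc k)\<close> raises the exponent \<open>a\<close> to \<open>a + 1\<close>: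
  exactly a term of the series for \<open>hpl (0 # m) x\<close>.\<close>

lemma S_sum_Cons_split_last:
  fixes t :: real
  assumes "t \<noteq> 0"
  shows "x ^ Suc k / (real (Suc k) * t ^ Suc k) * S_sum (a # n) (\<sigma> * t # b) (Suc k)
    = x ^ Suc k / (real (Suc k) * t ^ Suc k) * S_sum (a # n) (\<sigma> * t # b) k
      + \<sigma> ^ Suc k * x ^ Suc k / real (Suc k) ^ (a + 1) * S_sum n b (Suc k)"
proof -
  have "S_sum (a # n) (\<sigma> * t # b) (Suc k) = S_sum (a # n) (\<sigma> * t # b) k
      + (\<sigma> * t) ^ Suc k / real (Suc k) ^ a * S_sum n b (Suc k)"
    by simp
  moreover have "x ^ Suc k / (real (Suc k) * t ^ Suc k) * ((\<sigma> * t) ^ Suc k / real (Suc k) ^ a * s)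
      = \<sigma> ^ Suc k * x ^ Suc k / real (Suc k) ^ (a + 1) * s" for s
    using assms by (simp add: power_mult_distrib del: of_nat_Suc)
  ultimately show ?thesis
    by (simp only: distrib_left)
qed

theorem mainTheorem5:
  fixes m :: "real list" and q \<sigma> :: real and a :: nat
    and n :: "nat list" and b :: "real list"
  assumes m_nonzero: "\<exists>c \<in> set m. c \<noteq> 0"
    and q_def: "q = Min {\<bar>c\<bar> | c. c \<in> set m \<and> c \<noteq> 0}"
    and sigma: "\<sigma> \<noteq> 0"
    and a_pos: "a \<ge> 1"
    and len: "length n = length b"
    and n_pos: "\<forall>k \<in> set n. k \<ge> 1"
    and b_nonzero: "\<forall>c \<in> set b. c \<noteq> 0"
    and expansion: "\<forall>x. 0 < x \<and> x < q \<longrightarrow>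
      (\<lambda>i. \<sigma> ^ i * x ^ i / real i ^ a * S_sum n b i) sums\<^sub>1 hpl m x"
  shows "\<forall>j > 0. \<forall>x. 0 < x \<and> x < min j q \<longrightarrow>
    (\<lambda>i. \<sigma> ^ i * x ^ i / real i ^ (a + 1) * S_sum n b i) sums\<^sub>1 hpl (0 # m) x \<and>
    (\<lambda>i. x ^ i / (real i * j ^ i) * S_sum (a # n) (\<sigma> * j # b) (i - 1)) sums\<^sub>1 hpl (j # m) x \<and>
    (\<exists>A B. (\<lambda>i. x ^ i / (real i * j ^ i) * S_sum (a # n) (\<sigma> * j # b) i) sums\<^sub>1 A \<and>
           (\<lambda>i. \<sigma> ^ i * x ^ i / real i ^ (a + 1) * S_sum n b i) sums\<^sub>1 B \<and>
           hpl (j # m) x = A - B) \<and>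
    (\<exists>A. (\<lambda>i. x ^ i / (real i * (- j) ^ i) * S_sum (a # n) (- \<sigma> * j # b) (i - 1)) sums\<^sub>1 A \<and>
         hpl (- j # m) x = - A) \<and>
    (\<exists>A B. (\<lambda>i. x ^ i / (real i * (- j) ^ i) * S_sum (a # n) (- \<sigma> * j # b) i) sums\<^sub>1 A \<and>
           (\<lambda>i. \<sigma> ^ i * x ^ i / real i ^ (a + 1) * S_sum n b i) sums\<^sub>1 B \<and>
           hpl (- j # m) x = - A + B)"
proof (intro allI impI)
  fix j x :: real
  assume j: "j > 0" and x: "0 < x \<and> x < min j q"
  have expansion': "(\<lambda>i. \<sigma> ^ i * y ^ i / real i ^ a * S_sum n b i) sums\<^sub>1 hpl m y"
    if "0 < y" "y < q" for y
    using expansion that by blast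
  let ?c = "\<lambda>i. \<sigma> ^ i / real i ^ a * S_sum n b i"
  let ?B = "\<lambda>i. \<sigma> ^ i * x ^ i / real i ^ (a + 1) * S_sum n b i"
  have "(\<lambda>k. ?c (Suc k) * y ^ Suc k) sums hpl m y" if "0 < y" "y < q" for y
    using expansion'[OF that] by (simp add: mult_ac)
  from hpl_zero_Cons_sums[OF m_nonzero this]
  have "(\<lambda>k. ?c (Suc k) * x ^ Suc k / real (Suc k)) sums hpl (0 # m) x"
    using x by simp
  then have zero: "?B sums\<^sub>1 hpl (0 # m) x"
    by (simp add: mult_ac)
  have shifted: "(\<lambda>i. x ^ i / (real i * t ^ i) * S_sum (a # n) (\<sigma> * t # b) (i - 1))
      sums\<^sub>1 (sgn t * hpl (t # m) x)" if "\<bar>t\<bar> = j" for t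
    using that j x by (intro hpl_Cons_sums_S_sum[OF m_nonzero expansion']) auto
  \<comment> \<open>Restoring the last summands adds the series \<open>zero\<close> to
    \<open>shifted\<close>.\<close>
  have full: "(\<lambda>i. x ^ i / (real i * t ^ i) * S_sum (a # n) (\<sigma> * t # b) i)
      sums\<^sub>1 (sgn t * hpl (t # m) x + hpl (0 # m) x)" if "\<bar>t\<bar> = j" for t
  proof -
    have "t \<noteq> 0"
      using that j by auto
    from sums_add[OF shifted[OF that] zero] show ?thesis
      by (simp only: S_sum_Cons_split_last[OF \<open>t \<noteq> 0\<close>] diff_Suc_1)
  qed
  have minus: "\<sigma> * - j = - \<sigma> * j"
    by simp
  have pos: "\<bar>j\<bar> = j" "sgn j = 1" and neg: "\<bar>- j\<bar> = j" "sgn (- j) = - 1"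
    using j by simp_all
  show "?B sums\<^sub>1 hpl (0 # m) x \<and>
    (\<lambda>i. x ^ i / (real i * j ^ i) * S_sum (a # n) (\<sigma> * j # b) (i - 1)) sums\<^sub>1 hpl (j # m) x \<and>
    (\<exists>A B. (\<lambda>i. x ^ i / (real i * j ^ i) * S_sum (a # n) (\<sigma> * j # b) i) sums\<^sub>1 A \<and>
           ?B sums\<^sub>1 B \<and> hpl (j # m) x = A - B) \<and>
    (\<exists>A. (\<lambda>i. x ^ i / (real i * (- j) ^ i) * S_sum (a # n) (- \<sigma> * j # b) (i - 1)) sums\<^sub>1 A \<and>
         hpl (- j # m) x = - A) \<and>
    (\<exists>A B. (\<lambda>i. x ^ i / (real i * (- j) ^ i) * S_sum (a # n) (- \<sigma> * j # b) i) sums\<^sub>1 A \<and>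
           ?B sums\<^sub>1 B \<and> hpl (- j # m) x = - A + B)"
  \<comment> \<open>The witnesses are the sums found above: \<open>B\<close> is
    \<open>hpl (0 # m) x\<close>, and each \<open>A\<close> is the limit in \<open>shifted\<close>
    or \<open>full\<close> at \<open>t = j\<close> or \<open>t = - j\<close>. The remaining
    equations are linear in the values of \<open>hpl\<close>.\<close>
  proof (intro conjI exI)
    show "(\<lambda>i. x ^ i / (real i * j ^ i) * S_sum (a # n) (\<sigma> * j # b) (i - 1)) sums\<^sub>1 hpl (j # m) x"
      using shifted[OF pos(1)] unfolding pos(2) mult_1_left .
    show "(\<lambda>i. x ^ i / (real i * j ^ i) * S_sum (a # n) (\<sigma> * j # b) i)
        sums\<^sub>1 (hpl (j # m) x + hpl (0 # m) x)"
      using full[OF pos(1)] unfolding pos(2) mult_1_left .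
    show "(\<lambda>i. x ^ i / (real i * (- j) ^ i) * S_sum (a # n) (- \<sigma> * j # b) (i - 1))
        sums\<^sub>1 (- 1 * hpl (- j # m) x)"
      using shifted[OF neg(1)] unfolding neg(2) minus .
    show "(\<lambda>i. x ^ i / (real i * (- j) ^ i) * S_sum (a # n) (- \<sigma> * j # b) i)
        sums\<^sub>1 (- 1 * hpl (- j # m) x + hpl (0 # m) x)"
      using full[OF neg(1)] unfolding neg(2) minus .
  qed (rule zero | simp del: hpl.simps)+
qed

end
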